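(* Let $v$ be a partial isometry in $\mathbb{M}_2(\mathbb{C})$. If $v\in\mathcal{GN}(\Delta)$, then $$\mathrm{d}_{\mathrm{KK}}(\Delta,v\Delta v^* )\in\{0,1\}.$$ Moreover, for $u\in\mathcal{GN}(\Delta)$, we have $\mathrm{d}_{\mathrm{KK}}(\Delta,u\Delta u^* )=0$ if and only if $u\in\mathcal{UN}(\Delta)$. Consequently, no Hadamard unitary in $\mathbb{M}_2(\mathbb{C})$ belongs to $\mathcal{GN}(\Delta)$.
   Context: $\Delta$ denotes the algebra of diagonal matrices in $\mathbb{M}_2(\mathbb{C})$. Groupoid normaliser: $\mathcal{GN}(\Delta)=\{v\in\mathbb{M}_2(\mathbb{C}): v\Delta v^*\cup v^*\Delta v\subseteq\Delta\text{ and }vv^*v=v\}$. Unitary normaliser: $\mathcal{UN}(\Delta)=\{u\in\mathbb{M}_2(\mathbb{C})\text{ unitary}: u\Delta u^*=\Delta\}$. A Hadamard unitary in $\mathbb{M}_n(\mathbb{C})$ is a unitary $W$ with $|W_{ij}|=1/\sqrt n$ for all $i,j$. Kadison--Kastler distance: for subspaces $\mathcal{Y},\mathcal{Z}$ of a normed space (here $\mathbb{M}_2(\mathbb{C})$ with the operator norm), with closed unit balls $(\mathcal{Y})_1,(\mathcal{Z})_1$ and $d(x,S)=\inf\{\|x-s\|:s\in S\}$, $$\mathrm{d}_{\mathrm{KK}}(\mathcal{Y},\mathcal{Z})=\max\Big\{\sup_{y\in(\mathcal{Y})_1}d(y,(\mathcal{Z})_1),\ \sup_{z\in(\mathcal{Z})_1}d(z,(\mathcal{Y})_1)\Big\}.$$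 *)

theory Defs
  imports "HOL-Analysis.Analysis"
begin

definition cadjoint :: "complex^'n^'m \<Rightarrow> complex^'m^'n" where
  "cadjoint A = (\<chi> i j. cnj (A $ j $ i))"

text \<open>
  The library's norm on matrices is the Frobenius norm. The norm on \<^typ>\<open>complex^'n\<close> is the
  Hilbert space norm, and its \<^const>\<open>onorm\<close> is the C*-norm on matrices.
\<close>

definition op_norm :: "complex^'n^'m \<Rightarrow> real" where
  "op_norm A = onorm (\<lambda>x. A *v x)"

definition partial_isometry :: "complex^'n^'n \<Rightarrow> bool" where
  "partial_isometry v \<longleftrightarrow> v ** cadjoint v ** v = v"

definition unitary :: "complex^'n^'n \<Rightarrow> bool" where
  "unitary u \<longleftrightarrow> cadjoint u ** u = mat 1 \<and> u ** cadjoint u = mat 1"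

definition Delta :: "(complex^'n^'n) set" where
  "Delta = {A. \<forall>i j. i \<noteq> j \<longrightarrow> A $ i $ j = 0}"

definition conj_set :: "complex^'n^'n \<Rightarrow> (complex^'n^'n) set \<Rightarrow> (complex^'n^'n) set" where
  "conj_set v D = (\<lambda>d. v ** d ** cadjoint v) ` D"

definition groupoid_normaliser :: "(complex^'n^'n) set \<Rightarrow> (complex^'n^'n) set" where
  "groupoid_normaliser D = {v. conj_set v D \<union> conj_set (cadjoint v) D \<subseteq> D \<and> v ** cadjoint v ** v = v}"

definition unitary_normaliser :: "(complex^'n^'n) set \<Rightarrow> (complex^'n^'n) set" where
  "unitary_normaliser D = {u. unitary u \<and> conj_set u D = D}"

definition hadamard_unitary :: "complex^'n^'n \<Rightarrow> bool" where
  "hadamard_unitary W \<longleftrightarrow>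
     unitary W \<and> (\<forall>i j. cmod (W $ i $ j) = 1 / sqrt (real CARD('n)))"

text \<open>
  The norm is a parameter \<open>N\<close> of the following definitions because matrices are measured in
  \<^const>\<open>op_norm\<close> and not in the norm of their type class; this also excludes the library's
  \<^const>\<open>infdist\<close>. For subspaces all suprema and infima below are of nonempty bounded sets of reals.
\<close>

definition unit_ball_of :: "('a::real_vector \<Rightarrow> real) \<Rightarrow> 'a set \<Rightarrow> 'a set" where
  "unit_ball_of N Y = {y \<in> Y. N y \<le> 1}"

definition dist_to_set :: "('a::real_vector \<Rightarrow> real) \<Rightarrow> 'a \<Rightarrow> 'a set \<Rightarrow> real" where
  "dist_to_set N x S = (INF s\<in>S. N (x - s))"

definition d_KK :: "('a::real_vector \<Rightarrow> real) \<Rightarrow> 'a set \<Rightarrow> 'a set \<Rightarrow> real" where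
  "d_KK N Y Z =
     max (SUP y\<in>unit_ball_of N Y. dist_to_set N y (unit_ball_of N Z))
         (SUP z\<in>unit_ball_of N Z. dist_to_set N z (unit_ball_of N Y))"

end

theory Submission
  imports Defs
begin

text \<open>
  The projection \<open>v v\<^sup>*\<close> is diagonal with entries in \<open>{0, 1}\<close>. If all of them are \<open>1\<close>, then \<open>v\<close> is
  unitary and maps \<open>\<Delta>\<close> onto \<open>\<Delta>\<close>. Otherwise some row \<open>i\<close> of \<open>v\<close> vanishes, so every element of
  \<open>v \<Delta> v\<^sup>*\<close> has \<open>(i, i)\<close> entry \<open>0\<close> and is at distance at least \<open>1\<close> from the matrix unit
  \<open>e\<^sub>i\<^sub>i\<close>. A Hadamard unitary \<open>W\<close> fails to normalise because the off-diagonal entries of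
  \<open>W e\<^sub>j\<^sub>j W\<^sup>*\<close> do not vanish.
\<close>

lemma dist_to_set_le:
  assumes "\<And>a. 0 \<le> N a" "s \<in> S"
  shows "dist_to_set N x S \<le> N (x - s)"
  unfolding dist_to_set_def
  by (rule cINF_lower[OF _ assms(2)]) (auto intro!: bdd_belowI[of _ 0] assms(1))

lemma dist_to_set_nonneg:
  assumes "\<And>a. 0 \<le> N a" "S \<noteq> {}"
  shows "0 \<le> dist_to_set N x S"
  unfolding dist_to_set_def using assms by (auto intro: cINF_greatest)

text \<open>The point \<open>0\<close> of the other ball is a competitor in the infimum. This bound
  also makes the suprema in \<open>d_KK\<close> suprema of bounded sets.\<close>

lemma dist_to_set_unit_ball_le_1:
  assumes "\<And>a. 0 \<le> N a" "N 0 = 0" "0 \<in> Z" "y \<in> unit_ball_of N Y"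
  shows "dist_to_set N y (unit_ball_of N Z) \<le> 1"
proof -
  have "dist_to_set N y (unit_ball_of N Z) \<le> N (y - 0)"
    using assms by (intro dist_to_set_le) (auto simp: unit_ball_of_def)
  with assms(4) show ?thesis by (simp add: unit_ball_of_def)
qed

lemma d_KK_self:
  assumes "\<And>a. 0 \<le> N a" "N 0 = 0" "0 \<in> Y"
  shows "d_KK N Y Y = 0"
proof -
  have ne: "0 \<in> unit_ball_of N Y"
    using assms by (simp add: unit_ball_of_def)
  have "dist_to_set N y (unit_ball_of N Y) = 0" if "y \<in> unit_ball_of N Y" for y
    using dist_to_set_le[of N y "unit_ball_of N Y" y] dist_to_set_nonneg[of N "unit_ball_of N Y" y]
      assms that ne by fastforce
  then have "(SUP y\<in>unit_ball_of N Y. dist_to_set N y (unit_ball_of N Y))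
      = (SUP y\<in>unit_ball_of N Y. 0)"
    by (intro SUP_cong) auto
  also have "\<dots> = 0"
    using ne by (intro cSUP_const) auto
  finally show ?thesis unfolding d_KK_def by simp
qed

text \<open>Comparison with \<open>0\<close> bounds both suprema by \<open>1\<close>. The point
  \<open>y\<close> attains this bound in the first one, so the maximum is \<open>1\<close> whatever
  the second supremum is.\<close>

lemma d_KK_eq_1:
  assumes N: "\<And>a. 0 \<le> N a" "N 0 = 0" and zero: "0 \<in> Y" "0 \<in> Z"
    and y: "y \<in> Y" "N y \<le> 1" and far: "\<And>z. z \<in> Z \<Longrightarrow> 1 \<le> N (y - z)"
  shows "d_KK N Y Z = 1"
proof -
  have ball: "0 \<in> unit_ball_of N Y" "0 \<in> unit_ball_of N Z" "y \<in> unit_ball_of N Y"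
    using assms by (auto simp: unit_ball_of_def)
  have le: "(SUP y\<in>unit_ball_of N Y. dist_to_set N y (unit_ball_of N Z)) \<le> 1"
    "(SUP z\<in>unit_ball_of N Z. dist_to_set N z (unit_ball_of N Y)) \<le> 1"
    using ball N zero by (auto intro!: cSUP_least dist_to_set_unit_ball_le_1)
  have "1 \<le> dist_to_set N y (unit_ball_of N Z)"
    unfolding dist_to_set_def using ball far
    by (intro cINF_greatest) (auto simp: unit_ball_of_def)
  also have "\<dots> \<le> (SUP y\<in>unit_ball_of N Y. dist_to_set N y (unit_ball_of N Z))"
    using ball N zero
    by (intro cSUP_upper bdd_aboveI2[of _ _ 1]) (auto intro: dist_to_set_unit_ball_le_1)
  finally show ?thesis using le unfolding d_KK_def by simp
qed

text \<open>Real-linear maps on a finite-dimensional space are bounded; this makes the rules for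
  \<open>onorm\<close> applicable to \<open>op_norm\<close>.\<close>

lemma bounded_linear_complex_matrix_vector_mult:
  fixes A :: "complex^'n^'m"
  shows "bounded_linear (\<lambda>x. A *v x)"
  by (intro linear_conv_bounded_linear[THEN iffD1] linearI)
    (simp_all add: vec_eq_iff matrix_vector_mult_def scaleR_sum_right sum.distrib distrib_left)

lemma op_norm_nonneg: "0 \<le> op_norm A"
  unfolding op_norm_def by (intro onorm_pos_le bounded_linear_complex_matrix_vector_mult)

lemma op_norm_zero: "op_norm (0 :: complex^'n^'m) = 0"
proof -
  have "(*v) (0 :: complex^'n^'m) = (\<lambda>x. 0)"
    by (simp add: fun_eq_iff vec_eq_iff matrix_vector_mult_def)
  then show ?thesis unfolding op_norm_def by (simp add: onorm_zero)
qed

lemma norm_axis_complex: "norm (axis i c :: complex^'n) = cmod c"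
  by (simp add: norm_vec_def L2_set_def axis_def if_distrib[of norm] if_distrib[of "\<lambda>r. r\<^sup>2"]
      cong: if_cong)

text \<open>The entry is a coordinate of the image of the unit vector \<open>axis j 1\<close>. A
  single entry thus yields a lower bound for the operator norm.\<close>

lemma cmod_nth_le_op_norm:
  fixes A :: "complex^'n^'m"
  shows "cmod (A $ i $ j) \<le> op_norm A"
proof -
  have "cmod (A $ i $ j) = cmod ((A *v axis j 1) $ i)"
    by (simp add: matrix_vector_mult_def axis_def if_distrib[of "\<lambda>c. _ * c"] cong: if_cong)
  also have "\<dots> \<le> norm (A *v axis j 1)"
    by (rule Finite_Cartesian_Product.norm_nth_le)
  also have "\<dots> \<le> op_norm A * norm (axis j 1 :: complex^'n)"
    unfolding op_norm_def by (intro onorm bounded_linear_complex_matrix_vector_mult)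
  finally show ?thesis by (simp add: norm_axis_complex)
qed

definition diag_unit :: "'n \<Rightarrow> complex^'n^'n" where
  "diag_unit i = (\<chi> a b. if a = i \<and> b = i then 1 else 0)"

lemma diag_unit_in_Delta: "diag_unit i \<in> Delta"
  by (auto simp: diag_unit_def Delta_def)

lemma op_norm_diag_unit_le_1: "op_norm (diag_unit i) \<le> 1"
proof -
  \<comment> \<open>The matrix unit acts as a coordinate projection, which is a contraction.\<close>
  have "diag_unit i *v x = axis i (x $ i)" for x
    by (simp add: vec_eq_iff matrix_vector_mult_def diag_unit_def axis_def if_distrib[of "\<lambda>c. c * _"]
        if_bool_eq_conj cong: if_cong)
  then show ?thesis
    unfolding op_norm_def
    by (intro onorm_le) (simp add: norm_axis_complex Finite_Cartesian_Product.norm_nth_le)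
qed

lemma conj_nth:
  "(v ** d ** cadjoint v) $ i $ k = (\<Sum>j\<in>UNIV. (\<Sum>l\<in>UNIV. v $ i $ l * d $ l $ j) * cnj (v $ k $ j))"
  by (simp add: matrix_matrix_mult_def cadjoint_def)

text \<open>The conjugate is the rank-one matrix formed by column \<open>j\<close> of
  \<open>v\<close> and its adjoint.\<close>

lemma conj_diag_unit_nth:
  "(v ** diag_unit j ** cadjoint v) $ i $ k = v $ i $ j * cnj (v $ k $ j)"
proof -
  have "(\<Sum>l\<in>UNIV. v $ i $ l * diag_unit j $ l $ m) = (if m = j then v $ i $ j else 0)" for m
    by (auto simp: diag_unit_def if_distrib[of "\<lambda>c. _ * c"] cong: if_cong)
  then show ?thesis
    by (simp add: conj_nth if_distrib[of "\<lambda>c. c * _"] cong: if_cong)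
qed

lemma mat_1_in_Delta: "mat 1 \<in> Delta"
  by (simp add: Delta_def mat_def)

lemma zero_in_Delta: "0 \<in> Delta"
  by (simp add: Delta_def)

lemma zero_in_conj_set_Delta: "0 \<in> conj_set v Delta"
  unfolding conj_set_def
  by (rule image_eqI[OF _ zero_in_Delta]) (simp add: matrix_matrix_mult_def vec_eq_iff)

lemma cadjoint_cadjoint: "cadjoint (cadjoint v) = v"
  by (simp add: cadjoint_def vec_eq_iff)

text \<open>One inclusion is part of being a groupoid normaliser. For the other,
  \<open>cadjoint u ** d ** u\<close> lies in \<open>D\<close> and conjugation by \<open>u\<close>
  sends it back to \<open>d\<close>.\<close>

lemma unitary_normaliser_if_unitary:
  assumes "u \<in> groupoid_normaliser D" "unitary u"
  shows "u \<in> unitary_normaliser D"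
proof -
  have "d \<in> conj_set u D" if "d \<in> D" for d
  proof -
    have "cadjoint u ** d ** u \<in> D"
      using assms that by (auto simp: groupoid_normaliser_def conj_set_def cadjoint_cadjoint)
    moreover have "u ** (cadjoint u ** d ** u) ** cadjoint u
        = (u ** cadjoint u) ** d ** (u ** cadjoint u)"
      by (simp only: matrix_mul_assoc)
    then have "u ** (cadjoint u ** d ** u) ** cadjoint u = d"
      using assms(2) by (simp add: unitary_def)
    ultimately show ?thesis unfolding conj_set_def by (metis image_eqI)
  qed
  with assms show ?thesis
    by (auto simp: unitary_normaliser_def groupoid_normaliser_def)
qed

lemma groupoid_normaliser_zero_row:
  fixes v :: "complex^'n^'n"
  assumes v: "v \<in> groupoid_normaliser Delta" and "\<not> unitary v"
  obtains i where "\<And>j. v $ i $ j = 0"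
proof -
  define p where "p = v ** cadjoint v"
  \<comment> \<open>As the conjugate of the diagonal matrix \<open>mat 1\<close>, the range
    projection \<open>p\<close> is diagonal.\<close>
  have "p = v ** mat 1 ** cadjoint v" by (simp add: p_def)
  then have "p \<in> conj_set v Delta"
    unfolding conj_set_def by (rule image_eqI[OF _ mat_1_in_Delta])
  then have diag: "p $ i $ j = 0" if "i \<noteq> j" for i j
    using v that by (auto simp: groupoid_normaliser_def Delta_def)
  have "p ** p = p"
    using v by (simp add: p_def groupoid_normaliser_def matrix_mul_assoc)
  \<comment> \<open>Since \<open>p\<close> is diagonal, idempotence holds entry by entry on the
    diagonal.\<close>
  moreover have "(p ** p) $ i $ i = p $ i $ i * p $ i $ i" for i
  proof -
    have "(p ** p) $ i $ i = (\<Sum>k\<in>UNIV. if k = i then p $ i $ i * p $ i $ i else 0)"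
      by (auto simp: matrix_matrix_mult_def diag intro!: sum.cong simp del: sum.delta sum.delta')
    then show ?thesis by simp
  qed
  ultimately have idem: "p $ i $ i = 0 \<or> p $ i $ i = 1" for i
    by (metis mult_cancel_right1)
  obtain i where i: "p $ i $ i = 0"
  \<comment> \<open>If no diagonal entry vanished, \<open>p\<close> would be the identity. Then
    \<open>cadjoint v\<close> is a right inverse of the square matrix \<open>v\<close>, hence also a
    left inverse, and \<open>v\<close> is unitary.\<close>
  proof (rule ccontr)
    assume "\<not> thesis"
    with that idem have "p $ i $ i = 1" for i by blast
    with diag have "p = mat 1" by (simp add: vec_eq_iff mat_def)
    with assms(2) show False
      using matrix_left_right_inverse[of v "cadjoint v"] by (simp add: unitary_def p_def)
  qed
  \<comment> \<open>The entry \<open>p $ i $ i\<close> is the squared norm of row \<open>i\<close>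
    of \<open>v\<close>. As a sum of nonnegative reals it vanishes only if every term does.\<close>
  have "complex_of_real (\<Sum>j\<in>UNIV. (cmod (v $ i $ j))\<^sup>2) = 0"
    using i by (simp add: p_def matrix_matrix_mult_def cadjoint_def complex_norm_square del: of_real_power)
  then have "(\<Sum>j\<in>UNIV. (cmod (v $ i $ j))\<^sup>2) = 0"
    by (simp only: of_real_eq_0_iff)
  then have "v $ i $ j = 0" for j
    by (simp add: sum_nonneg_eq_0_iff)
  with that show ?thesis .
qed

lemma d_KK_unitary_normaliser:
  assumes "u \<in> unitary_normaliser Delta"
  shows "d_KK op_norm Delta (conj_set u Delta) = 0"
  using assms
  by (simp add: unitary_normaliser_def d_KK_self op_norm_nonneg op_norm_zero zero_in_Delta)

lemma d_KK_not_unitary: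
  assumes "v \<in> groupoid_normaliser Delta" "\<not> unitary v"
  shows "d_KK op_norm Delta (conj_set v Delta) = 1"
proof -
  obtain i where i: "\<And>j. v $ i $ j = 0"
    using groupoid_normaliser_zero_row[OF assms] by blast
  have "1 \<le> op_norm (diag_unit i - z)" if "z \<in> conj_set v Delta" for z
  proof -
    \<comment> \<open>Hence the entry of \<open>diag_unit i - z\<close> at \<open>(i, i)\<close> is
      \<open>1\<close>, and it bounds the operator norm from below.\<close>
    have "z $ i $ i = 0"
      using that i by (auto simp: conj_set_def conj_nth)
    then show ?thesis
      using cmod_nth_le_op_norm[of "diag_unit i - z" i i] by (simp add: diag_unit_def)
  qed
  then show ?thesis
    by (intro d_KK_eq_1[where y = "diag_unit i"] op_norm_nonneg op_norm_zero zero_in_Delta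
        zero_in_conj_set_Delta diag_unit_in_Delta op_norm_diag_unit_le_1)
qed

lemma hadamard_unitary_not_groupoid_normaliser:
  fixes W :: "complex^'n^'n"
  assumes "hadamard_unitary W" "CARD('n) \<ge> 2"
  shows "W \<notin> groupoid_normaliser Delta"
proof
  assume W: "W \<in> groupoid_normaliser Delta"
  obtain i k :: 'n where "i \<noteq> k"
    using assms(2) card_2_iff' by (metis UNIV_I card_le_Suc0_iff_eq finite numeral_2_eq_2 not_less_eq_eq)
  moreover have "W ** diag_unit i ** cadjoint W \<in> Delta"
    using W diag_unit_in_Delta by (auto simp: groupoid_normaliser_def conj_set_def)
  \<comment> \<open>This product is the off-diagonal entry at \<open>(i, k)\<close> of the conjugate
    of \<open>diag_unit i\<close>, yet both factors have modulus
    \<open>1 / sqrt (real CARD('n))\<close>.\<close>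
  ultimately have "W $ i $ i * cnj (W $ k $ i) = 0"
    by (auto simp: Delta_def simp flip: conj_diag_unit_nth)
  moreover have "W $ a $ b \<noteq> 0" for a b
  proof -
    have "cmod (W $ a $ b) = 1 / sqrt (real CARD('n))"
      using assms(1) by (simp add: hadamard_unitary_def)
    then show ?thesis by auto
  qed
  ultimately show False by simp
qed

theorem corollary3p17:
  shows "(\<forall>v :: complex^2^2. partial_isometry v \<longrightarrow> v \<in> groupoid_normaliser Delta \<longrightarrow>
            d_KK op_norm Delta (conj_set v Delta) \<in> {0, 1})
       \<and> (\<forall>u :: complex^2^2. u \<in> groupoid_normaliser Delta \<longrightarrow>
            (d_KK op_norm Delta (conj_set u Delta) = 0 \<longleftrightarrow> u \<in> unitary_normaliser Delta))
       \<and> (\<forall>W :: complex^2^2. hadamard_unitary W \<longrightarrow> W \<notin> groupoid_normaliser Delta)"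
proof (intro conjI allI impI)
  fix v :: "complex^2^2"
  assume "v \<in> groupoid_normaliser Delta"
  then show "d_KK op_norm Delta (conj_set v Delta) \<in> {0, 1}"
    using d_KK_not_unitary d_KK_unitary_normaliser unitary_normaliser_if_unitary by blast
next
  fix u :: "complex^2^2"
  assume u: "u \<in> groupoid_normaliser Delta"
  show "d_KK op_norm Delta (conj_set u Delta) = 0 \<longleftrightarrow> u \<in> unitary_normaliser Delta"
    \<comment> \<open>If \<open>u\<close> is not a unitary normaliser, it is not unitary, so the
      distance is \<open>1\<close> and not \<open>0\<close>.\<close>
    using d_KK_not_unitary[OF u] d_KK_unitary_normaliser[of u] unitary_normaliser_if_unitary[OF u]
    by (metis zero_neq_one)
next
  fix W :: "complex^2^2"
  assume "hadamard_unitary W"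
  then show "W \<notin> groupoid_normaliser Delta"
    by (rule hadamard_unitary_not_groupoid_normaliser) simp
qed

end
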